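(* Let $U_0\in (V_{N_g})^N\cap\mathcal M^N$, let $\Delta t_n>0$ for $n\in\mathbb N$, and let $\{U_n\}_{n\in\mathbb N}\subset (V_{N_g})^N$ be obtained from the midpoint scheme, i.e. for every $n$ $$\frac{U_{n+1}-U_n}{\Delta t_n}=-\nabla_G E(U_{n+1/2}),\qquad U_{n+1/2}=\frac{U_{n+1}+U_n}2 .$$ Then for every $n$ the spectrum of the $N\times N$ matrix $\langle U_{n+1/2}^\top U_{n+1/2}\rangle$ satisfies $$\sigma\big(\langle U_{n+1/2}^\top U_{n+1/2}\rangle\big)\subset[0,1].$$
   Context: Setting. $N\ge 1$; $V_{N_g}\subset H^1(\mathbb R^3)$ is a finite-dimensional space (dimension $N_g$) of real-valued functions. For $N$-tuples $\Psi,\Phi$ of functions, $\langle\Psi^\top\Phi\rangle=((\psi_i,\varphi_j)_{L^2(\mathbb R^3)})_{i,j=1}^N$, $(\Psi,\Phi)=\mathrm{tr}\langle\Psi^\top\Phi\rangle$. For $P\in\mathbb R^{N\times N}$, $UP$ is the $N$-tuple with $i$-th entry $\sum_j p_{ji}u_j$. $\mathcal M^N=\{U\in (H^1(\mathbb R^3))^N:\langle U^\top U\rangle=I_N\}$. Energy. $E$ is the Kohn-Sham energy $$E(U)=\sum_{i=1}^N\int_{\mathbb R^3}|\nabla u_i|^2\,dr+\int_{\mathbb R^3}V_{ext}\rho_U\,dr+\frac12\iint\frac{\rho_U(r)\rho_U(r')}{|r-r'|}\,dr\,dr'+\int_{\mathbb R^3}\varepsilon_{xc}(\rho_U)\rho_U\,dr,\qquad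 \rho_U=2\sum_{i=1}^N|u_i|^2,$$ where $V_{ext}$ is the external potential (for full potential calculations $V_{ext}(r)=-\sum_{I=1}^M Z_I/|r-R_I|$). The exchange-correlation term is assumed differentiable, with potential $v_{xc}(\rho)=\delta(\rho\,\varepsilon_{xc}(\rho))/\delta\rho$; thus $E$ is differentiable on $(V_{N_g})^N$, and $\nabla E(U)\in (V_{N_g})^N$ denotes its gradient with respect to $(\cdot,\cdot)$, i.e. for every $v\in V_{N_g}$ $$((\nabla E(U))_i,v)_{L^2}=4\Big(\tfrac12(\nabla u_i,\nabla v)_{L^2}+(V_{ext}u_i,v)_{L^2}+\Big(\int\frac{\rho_U(r')}{|\cdot-r'|}dr'\,u_i,v\Big)_{L^2}+(v_{xc}(\rho_U)u_i,v)_{L^2}\Big).$$ In particular $\langle U^\top\nabla E(U)\rangle$ is symmetric. Extended Grassmann gradient. For $U\in (V_{N_g})^N$, $\nabla_G E(U)=\nabla E(U)\langle U^\top U\rangle-U\langle U^\top\nabla E(U)\rangle$. *)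

theory Defs
  imports "HOL-Analysis.Analysis"
begin

type_synonym func = "real^3 \<Rightarrow> real"
type_synonym 'n tuple = "'n \<Rightarrow> func"

subsection \<open>The Sobolev space \<open>H\<^sup>1(\<real>\<^sup>3)\<close>\<close>

definition partial_deriv :: "3 \<Rightarrow> func \<Rightarrow> func" where
  "partial_deriv i f = (\<lambda>x. frechet_derivative f (at x) (axis i 1))"

primrec Ck :: "nat \<Rightarrow> func \<Rightarrow> bool" where
  "Ck 0 f \<longleftrightarrow> continuous_on UNIV f"
| "Ck (Suc k) f \<longleftrightarrow> f differentiable_on UNIV \<and> (\<forall>i. Ck k (partial_deriv i f))"

definition test_function :: "func \<Rightarrow> bool" where
  "test_function \<phi> \<longleftrightarrow> (\<forall>k. Ck k \<phi>) \<and> compact (closure {x. \<phi> x \<noteq> 0})"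

definition L2 :: "(real^3 \<Rightarrow> 'b::{real_normed_vector,second_countable_topology}) \<Rightarrow> bool" where
  "L2 f \<longleftrightarrow> f \<in> borel_measurable lborel \<and> integrable lborel (\<lambda>x. (norm (f x))\<^sup>2)"

definition is_weak_gradient :: "func \<Rightarrow> (real^3 \<Rightarrow> real^3) \<Rightarrow> bool" where
  "is_weak_gradient u g \<longleftrightarrow>
     (\<forall>\<phi> i. test_function \<phi> \<longrightarrow>
        (LINT x|lborel. u x * partial_deriv i \<phi> x) = - (LINT x|lborel. g x $ i * \<phi> x))"

definition H1 :: "func set" where
  "H1 = {u. L2 u \<and> (\<exists>g. L2 g \<and> is_weak_gradient u g)}"

text \<open>The weak gradient of an element of \<open>H1\<close> is determined up to a null set; every use below is
  under an integral, so the choice of the representative is immaterial.\<close>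

definition weak_gradient :: "func \<Rightarrow> real^3 \<Rightarrow> real^3" where
  "weak_gradient u = (SOME g. L2 g \<and> is_weak_gradient u g)"

text \<open>An \<open>m\<close>-dimensional subspace of \<open>H1\<close>. Elements of \<open>H1\<close> are functions rather than classes modulo
  null sets, so linear independence of the basis is required modulo null sets. Hence two elements
  of \<open>V\<close> that agree almost everywhere are equal, and \<open>V\<close> maps bijectively onto a subspace of
  classes; conversely every \<open>m\<close>-dimensional space of classes arises by choosing
  representatives of a basis.\<close>

definition H1_subspace_dim :: "func set \<Rightarrow> nat \<Rightarrow> bool" where
  "H1_subspace_dim V m \<longleftrightarrow>
     (\<exists>\<phi>::nat \<Rightarrow> func.
        (\<forall>k<m. \<phi> k \<in> H1) \<and>
        (\<forall>c::nat \<Rightarrow> real. (AE x in lborel. (\<Sum>k<m. c k * \<phi> k x) = 0) \<longrightarrow> (\<forall>k<m. c k = 0)) \<and>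
        V = {(\<lambda>x. \<Sum>k<m. c k * \<phi> k x) | c::nat \<Rightarrow> real. True})"

subsection \<open>Tuples of functions\<close>

definition tuples :: "func set \<Rightarrow> 'n tuple set" where
  "tuples V = {U. \<forall>i. U i \<in> V}"

definition l2_inner :: "func \<Rightarrow> func \<Rightarrow> real" where
  "l2_inner f g = (LINT x|lborel. f x * g x)"

definition gram :: "('n::finite) tuple \<Rightarrow> 'n tuple \<Rightarrow> real^'n^'n" where
  "gram \<Psi> \<Phi> = (\<chi> i j. l2_inner (\<Psi> i) (\<Phi> j))"

definition tuple_inner :: "('n::finite) tuple \<Rightarrow> 'n tuple \<Rightarrow> real" where
  "tuple_inner \<Psi> \<Phi> = trace (gram \<Psi> \<Phi>)"

definition tuple_norm :: "('n::finite) tuple \<Rightarrow> real" where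
  "tuple_norm \<Psi> = sqrt (tuple_inner \<Psi> \<Psi>)"

definition tuple_diff :: "'n tuple \<Rightarrow> 'n tuple \<Rightarrow> 'n tuple" where
  "tuple_diff \<Psi> \<Phi> = (\<lambda>i x. \<Psi> i x - \<Phi> i x)"

definition tuple_mult :: "('n::finite) tuple \<Rightarrow> real^'n^'n \<Rightarrow> 'n tuple" where
  "tuple_mult U P = (\<lambda>i x. \<Sum>j\<in>UNIV. P $ j $ i * U j x)"

definition tuple_midpoint :: "'n tuple \<Rightarrow> 'n tuple \<Rightarrow> 'n tuple" where
  "tuple_midpoint U W = (\<lambda>i x. (W i x + U i x) / 2)"

definition stiefel :: "('n::finite) tuple set" where
  "stiefel = {U \<in> tuples H1. gram U U = mat 1}"

subsection \<open>The Kohn-Sham energy\<close>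

definition density :: "('n::finite) tuple \<Rightarrow> func" where
  "density U = (\<lambda>r. 2 * (\<Sum>i\<in>UNIV. \<bar>U i r\<bar>\<^sup>2))"

definition hartree_potential :: "func \<Rightarrow> func" where
  "hartree_potential \<rho> = (\<lambda>r. LINT r'|lborel. \<rho> r' / norm (r - r'))"

text \<open>\<open>\<epsilon>xc\<close> and \<open>vxc\<close> send a density to a function on space, so that they may depend on the
  density locally or through, for instance, its gradient.\<close>

definition xc_energy :: "(func \<Rightarrow> func) \<Rightarrow> func \<Rightarrow> real" where
  "xc_energy \<epsilon>xc \<rho> = (LINT r|lborel. \<epsilon>xc \<rho> r * \<rho> r)"

definition energy :: "func \<Rightarrow> (func \<Rightarrow> func) \<Rightarrow> ('n::finite) tuple \<Rightarrow> real" where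
  "energy Vext \<epsilon>xc U =
     (\<Sum>i\<in>UNIV. LINT r|lborel. (norm (weak_gradient (U i) r))\<^sup>2)
     + (LINT r|lborel. Vext r * density U r)
     + 1/2 * (LINT r|lborel. LINT r'|lborel. density U r * density U r' / norm (r - r'))
     + xc_energy \<epsilon>xc (density U)"

definition external_potential_on :: "func set \<Rightarrow> func \<Rightarrow> bool" where
  "external_potential_on V Vext \<longleftrightarrow>
     Vext \<in> borel_measurable lborel \<and>
     (\<forall>u\<in>V. \<forall>v\<in>V. integrable lborel (\<lambda>r. Vext r * u r * v r))"

text \<open>The densities of arbitrary finite tuples from \<open>V\<close>. They form the convex cone generated by
  the densities of the tuples of one fixed length, which makes differentiation along segments
  meaningful; differences of two of them span all products of elements of \<open>V\<close>.\<close>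

definition densities :: "func set \<Rightarrow> func set" where
  "densities V = {(\<lambda>r. 2 * (\<Sum>k<m. \<bar>w k r\<bar>\<^sup>2)) | (m::nat) w. \<forall>k<m. w k \<in> V}"

text \<open>\<open>vxc \<rho>\<close> is the functional derivative of the exchange-correlation energy at \<open>\<rho>\<close>. The derivative
  is one-sided because leaving the segment may destroy nonnegativity of the density.\<close>

definition xc_potential_on :: "func set \<Rightarrow> (func \<Rightarrow> func) \<Rightarrow> (func \<Rightarrow> func) \<Rightarrow> bool" where
  "xc_potential_on V \<epsilon>xc vxc \<longleftrightarrow>
     (\<forall>\<rho>\<in>densities V.
        integrable lborel (\<lambda>r. \<epsilon>xc \<rho> r * \<rho> r) \<and>
        (\<forall>u\<in>V. \<forall>v\<in>V. integrable lborel (\<lambda>r. vxc \<rho> r * u r * v r)) \<and>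
        (\<forall>\<sigma>\<in>densities V.
           ((\<lambda>t. xc_energy \<epsilon>xc (\<lambda>r. \<rho> r + t * (\<sigma> r - \<rho> r)))
              has_real_derivative (LINT r|lborel. vxc \<rho> r * (\<sigma> r - \<rho> r))) (at 0 within {0..1})))"

subsection \<open>Gradients\<close>

text \<open>\<open>G\<close> represents, with respect to \<open>tuple_inner\<close>, the Frechet derivative at \<open>U\<close> of the function
  \<open>F\<close> on the finite-dimensional space \<open>tuples V\<close>.\<close>

definition has_gradient_on ::
    "func set \<Rightarrow> (('n::finite) tuple \<Rightarrow> real) \<Rightarrow> 'n tuple \<Rightarrow> 'n tuple \<Rightarrow> bool" where
  "has_gradient_on V F U G \<longleftrightarrow>
     G \<in> tuples V \<and>
     (\<forall>e>0. \<exists>d>0. \<forall>W\<in>tuples V. tuple_norm (tuple_diff W U) < d \<longrightarrow>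
        \<bar>F W - F U - tuple_inner G (tuple_diff W U)\<bar> \<le> e * tuple_norm (tuple_diff W U))"

text \<open>The explicit form of the gradient of the energy. The factor 4 is the 2 in the density times
  the 2 from differentiating the square; the kinetic term has no factor 2 from the density.\<close>

definition kohn_sham_gradient_formula ::
    "func set \<Rightarrow> func \<Rightarrow> (func \<Rightarrow> func) \<Rightarrow> ('n::finite) tuple \<Rightarrow> 'n tuple \<Rightarrow> bool" where
  "kohn_sham_gradient_formula V Vext vxc U G \<longleftrightarrow>
     (\<forall>i. \<forall>v\<in>V.
        l2_inner (G i) v =
          4 * (1/2 * (LINT r|lborel. weak_gradient (U i) r \<bullet> weak_gradient v r)
               + l2_inner (\<lambda>r. Vext r * U i r) v
               + l2_inner (\<lambda>r. hartree_potential (density U) r * U i r) v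
               + l2_inner (\<lambda>r. vxc (density U) r * U i r) v))"

definition grassmann_gradient ::
    "(('n::finite) tuple \<Rightarrow> 'n tuple) \<Rightarrow> 'n tuple \<Rightarrow> 'n tuple" where
  "grassmann_gradient gradE U =
     tuple_diff (tuple_mult (gradE U) (gram U U)) (tuple_mult U (gram U (gradE U)))"

subsection \<open>Spectrum\<close>

definition spectrum :: "complex^'n^'n \<Rightarrow> complex set" where
  "spectrum A = {z. \<not> invertible (A - mat z)}"

end

theory Submission
  imports Defs
begin

text \<open>Write \<open>W\<close> for the midpoint, \<open>S\<close> and \<open>A\<close> for the Gram matrices of \<open>W\<close> with itself and with
  \<open>D = \<nabla>E(W)\<close>, and \<open>K = \<nabla>\<^sub>GE(W)\<close>. Since \<open>S\<close> and \<open>A\<close> are symmetric, \<open>\<langle>W\<^sup>TK\<rangle> = AS - SA\<close>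
  is antisymmetric. The two ends of the step are \<open>W + cK\<close> and \<open>W - cK\<close> with \<open>c = \<Delta>t/2\<close>, and hence both
  have the Gram matrix \<open>S + c\<^sup>2\<langle>K\<^sup>TK\<rangle>\<close>. So the scheme preserves orthonormality, and
  \<open>S = I - c\<^sup>2\<langle>K\<^sup>TK\<rangle>\<close> lies between \<open>0\<close> and \<open>I\<close> as a quadratic form.\<close>

section \<open>Square-integrable functions and their inner product\<close>

lemma L2_mult_integrable:
  fixes f g :: func
  assumes "L2 f" "L2 g"
  shows "integrable lborel (\<lambda>x. f x * g x)"
proof (rule Bochner_Integration.integrable_bound)
  show "integrable lborel (\<lambda>x. (f x)\<^sup>2 + (g x)\<^sup>2)"
    using assms by (auto simp: L2_def)
  show "(\<lambda>x. f x * g x) \<in> borel_measurable lborel"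
    using assms by (auto simp: L2_def)
  \<comment> \<open>The domination comes from \<open>2 * |a| * |b| \<le> |a|^2 + |b|^2\<close>; the
    factor 2 is given away.\<close>
  have "\<bar>a * b\<bar> \<le> a\<^sup>2 + b\<^sup>2" for a b :: real
    using sum_squares_bound[of "\<bar>a\<bar>" "\<bar>b\<bar>"] abs_ge_zero[of "a * b"]
    unfolding abs_mult power2_abs by linarith
  then show "AE x in lborel. norm (f x * g x) \<le> norm ((f x)\<^sup>2 + (g x)\<^sup>2)"
    by (simp add: power2_eq_square)
qed

lemma L2_lincomb:
  fixes f g :: func
  assumes "L2 f" "L2 g"
  shows "L2 (\<lambda>x. a * f x + b * g x)"
proof -
  have "integrable lborel (\<lambda>x. a\<^sup>2 * (f x * f x) + 2 * a * b * (f x * g x) + b\<^sup>2 * (g x * g x))"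
    using assms by (intro Bochner_Integration.integrable_add integrable_mult_right L2_mult_integrable)
  moreover have "a\<^sup>2 * (f x * f x) + 2 * a * b * (f x * g x) + b\<^sup>2 * (g x * g x)
      = (a * f x + b * g x)\<^sup>2" for x
    by (simp add: power2_eq_square algebra_simps)
  ultimately show ?thesis
    using assms by (auto simp: L2_def)
qed

lemma L2_sum:
  fixes f :: "'k \<Rightarrow> func"
  assumes "\<And>k. k \<in> A \<Longrightarrow> L2 (f k)"
  shows "L2 (\<lambda>x. \<Sum>k\<in>A. c k * f k x)"
  using assms
\<comment> \<open>For infinite \<open>A\<close> the sum is \<open>0\<close> by convention, and the
  zero function is square integrable.\<close>
proof (induction A rule: infinite_finite_induct)
  case (insert k A)
  then show ?case
    using L2_lincomb[of "f k" "\<lambda>x. \<Sum>k\<in>A. c k * f k x" "c k" 1] by simp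
qed (auto simp: L2_def)

lemma l2_inner_commute: "l2_inner f g = l2_inner g f"
  by (simp add: l2_inner_def mult.commute)

lemma l2_inner_lincomb_left:
  assumes "L2 f" "L2 g" "L2 h"
  shows "l2_inner (\<lambda>x. a * f x + b * g x) h = a * l2_inner f h + b * l2_inner g h"
proof -
  have "l2_inner (\<lambda>x. a * f x + b * g x) h
      = (LINT x|lborel. a * (f x * h x) + b * (g x * h x))"
    by (simp add: l2_inner_def algebra_simps)
  then show ?thesis
    using assms by (simp add: L2_mult_integrable l2_inner_def)
qed

lemma l2_inner_sum_right:
  assumes "L2 h" "\<And>k. k \<in> A \<Longrightarrow> L2 (f k)"
  shows "l2_inner h (\<lambda>x. \<Sum>k\<in>A. c k * f k x) = (\<Sum>k\<in>A. c k * l2_inner h (f k))"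
proof -
  have "l2_inner h (\<lambda>x. \<Sum>k\<in>A. c k * f k x)
      = (LINT x|lborel. (\<Sum>k\<in>A. c k * (h x * f k x)))"
    by (simp add: l2_inner_def sum_distrib_left mult.left_commute)
  then show ?thesis
    using assms by (simp add: L2_mult_integrable l2_inner_def)
qed

section \<open>Gram matrices of tuples\<close>

lemma gram_nth: "gram X Y $ i $ j = l2_inner (X i) (Y j)"
  by (simp add: gram_def)

lemma transpose_gram: "transpose (gram X Y) = gram Y X"
  by (simp add: vec_eq_iff transpose_def gram_nth l2_inner_commute)

lemma gram_tuple_diff_right:
  assumes "\<And>i. L2 (X i)" "\<And>i. L2 (Y i)" "\<And>i. L2 (Z i)"
  shows "gram X (tuple_diff Y Z) = gram X Y - gram X Z"
proof -
  have "l2_inner (X i) (tuple_diff Y Z j) = l2_inner (X i) (Y j) - l2_inner (X i) (Z j)" for i j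
    using assms l2_inner_lincomb_left[of "Y j" "Z j" "X i" 1 "-1"]
    by (simp add: tuple_diff_def l2_inner_commute[of "X i"])
  then show ?thesis
    by (simp add: vec_eq_iff gram_nth)
qed

text \<open>Entry \<open>i\<close> of \<open>tuple_mult Y P\<close> takes its coefficients from
  column \<open>i\<close> of \<open>P\<close>, so \<open>P\<close> comes out as a right
  factor.\<close>

lemma gram_tuple_mult_right:
  assumes "\<And>i. L2 (X i)" "\<And>i. L2 (Y i)"
  shows "gram X (tuple_mult Y P) = gram X Y ** P"
  using assms
  by (simp add: vec_eq_iff gram_nth tuple_mult_def matrix_matrix_mult_def l2_inner_sum_right
      mult.commute[of "l2_inner _ _"])

lemma L2_tuple_diff:
  assumes "\<And>i. L2 (X i)" "\<And>i. L2 (Y i)"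
  shows "L2 (tuple_diff X Y i)"
  using assms L2_lincomb[of "X i" "Y i" 1 "-1"] by (simp add: tuple_diff_def)

lemma L2_tuple_mult:
  assumes "\<And>i. L2 (X i)"
  shows "L2 (tuple_mult X P i)"
  using assms by (simp add: tuple_mult_def L2_sum)

text \<open>Bilinear expansion. The part linear in \<open>c\<close> is kept together, because it
  vanishes once \<open>gram X Y\<close> is antisymmetric.\<close>

lemma gram_add_scaled:
  fixes X Y :: "('n::finite) tuple"
  assumes "\<And>i. L2 (X i)" "\<And>i. L2 (Y i)"
  shows "gram (\<lambda>i x. X i x + c * Y i x) (\<lambda>i x. X i x + c * Y i x)
      = gram X X + c *\<^sub>R (gram X Y + gram Y X) + c\<^sup>2 *\<^sub>R gram Y Y"
proof -
  define Z where "Z = (\<lambda>i x. X i x + c * Y i x)"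
  have L2_Z: "L2 (Z i)" for i
    using assms L2_lincomb[of "X i" "Y i" 1 c] by (simp add: Z_def)
  have left: "l2_inner (Z i) h = l2_inner (X i) h + c * l2_inner (Y i) h" if "L2 h" for i h
    using assms that l2_inner_lincomb_left[of "X i" "Y i" h 1 c] by (simp add: Z_def)
  have right: "l2_inner h (Z i) = l2_inner h (X i) + c * l2_inner h (Y i)" if "L2 h" for i h
    using left[OF that] by (simp add: l2_inner_commute)
  have "l2_inner (Z i) (Z j) = (gram X X + c *\<^sub>R (gram X Y + gram Y X) + c\<^sup>2 *\<^sub>R gram Y Y) $ i $ j"
    for i j
    by (simp add: left right L2_Z assms gram_nth power2_eq_square algebra_simps)
  then show ?thesis
    by (simp add: vec_eq_iff gram_nth flip: Z_def)
qed

text \<open>The quadratic form is the squared norm of the single function \<open>f\<close>, the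
  combination of the entries of \<open>X\<close> with coefficients \<open>v\<close>.\<close>

lemma gram_form_nonneg:
  assumes "\<And>i. L2 (X i)"
  shows "0 \<le> v \<bullet> (gram X X *v v)"
proof -
  define f where "f = (\<lambda>x. \<Sum>i\<in>UNIV. v $ i * X i x)"
  have "L2 f"
    using assms by (simp add: f_def L2_sum)
  have "v \<bullet> (gram X X *v v) = (\<Sum>i\<in>UNIV. v $ i * l2_inner (X i) f)"
    using assms
    by (simp add: inner_vec_def matrix_vector_mult_def gram_nth f_def l2_inner_sum_right
        mult.commute[of "l2_inner _ _"])
  also have "\<dots> = (\<Sum>i\<in>UNIV. v $ i * l2_inner f (X i))"
    by (simp only: l2_inner_commute[of f])
  also have "\<dots> = l2_inner f f"
    using l2_inner_sum_right[OF \<open>L2 f\<close>, of UNIV X "\<lambda>i. v $ i"] assms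
    unfolding f_def[symmetric] by simp
  also have "\<dots> \<ge> 0"
    by (simp add: l2_inner_def)
  finally show ?thesis .
qed

section \<open>Symmetric matrices and their spectrum\<close>

lemma commutator_add_transpose:
  fixes A S :: "real^'n^'n"
  assumes "transpose A = A" "transpose S = S"
  shows "(A ** S - S ** A) + transpose (A ** S - S ** A) = 0"
proof -
  have "transpose (X - Y) = transpose X - transpose Y" for X Y :: "real^'n^'n"
    by (simp add: vec_eq_iff transpose_def)
  then show ?thesis
    using assms by (simp add: matrix_transpose_mul)
qed

text \<open>Bounds on the real quadratic form control complex eigenvalues: an eigenvector is split
  into real and imaginary parts, symmetry makes the eigenvalue real, and the form at both parts
  locates it.\<close>

lemma spectrum_symmetric_subset:
  fixes S :: "real^'n^'n"
  assumes sym: "transpose S = S"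
    and lower: "\<And>v. a * (v \<bullet> v) \<le> v \<bullet> (S *v v)"
    and upper: "\<And>v. v \<bullet> (S *v v) \<le> b * (v \<bullet> v)"
  shows "spectrum (map_matrix complex_of_real S) \<subseteq> complex_of_real ` {a..b}"
proof
  fix z assume "z \<in> spectrum (map_matrix complex_of_real S)"
  then have "\<not> invertible (map_matrix complex_of_real S - mat z)"
    by (simp add: spectrum_def)
  then obtain x where "x \<noteq> 0" and "(map_matrix complex_of_real S - mat z) *v x = 0"
    unfolding invertible_left_inverse matrix_left_invertible_ker by blast
  then have eigen: "map_matrix complex_of_real S *v x = z *s x"
    by (simp add: matrix_vector_mult_diff_rdistrib vec_eq_iff[of _ "z *s x"])
       (simp add: matrix_vector_mult_def mat_def if_distrib[of "\<lambda>a. a * _"] cong: if_cong)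
  define u w where "u = (\<chi> i. Re (x $ i))" and "w = (\<chi> i. Im (x $ i))"
  have entry: "(\<Sum>j\<in>UNIV. complex_of_real (S $ i $ j) * x $ j) = z * x $ i" for i
    using arg_cong[OF eigen, of "\<lambda>y. y $ i"] by (simp add: matrix_vector_mult_def)
  have Su: "S *v u = Re z *\<^sub>R u - Im z *\<^sub>R w"
    using arg_cong[OF entry, of Re]
    by (simp add: vec_eq_iff matrix_vector_mult_def u_def w_def)
  have Sw: "S *v w = Im z *\<^sub>R u + Re z *\<^sub>R w"
    using arg_cong[OF entry, of Im]
    by (simp add: vec_eq_iff matrix_vector_mult_def u_def w_def add.commute)
  have "u \<noteq> 0 \<or> w \<noteq> 0"
    using \<open>x \<noteq> 0\<close> by (auto simp: vec_eq_iff u_def w_def complex_eq_iff)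
  then have pos: "0 < u \<bullet> u + w \<bullet> w"
    by (metis add_pos_nonneg add_nonneg_pos inner_gt_zero_iff inner_ge_zero)
  \<comment> \<open>Inserting \<open>Su\<close> and \<open>Sw\<close>, the terms with
    \<open>Re z\<close> cancel and only \<open>Im z\<close> times the squared length of
    \<open>x\<close> remains.\<close>
  have "w \<bullet> (S *v u) = u \<bullet> (S *v w)"
    using sym by (metis dot_lmul_matrix inner_commute transpose_matrix_vector)
  then have "Im z * (u \<bullet> u + w \<bullet> w) = 0"
    by (simp add: Su Sw inner_diff_right inner_add_right inner_commute algebra_simps)
  then have "Im z = 0"
    using pos by simp
  \<comment> \<open>Either of \<open>u\<close> and \<open>w\<close> may be zero, so the bounds at
    both are added before dividing by the positive sum.\<close>
  moreover have "a * (u \<bullet> u + w \<bullet> w) \<le> Re z * (u \<bullet> u + w \<bullet> w)"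
    using lower[of u] lower[of w] \<open>Im z = 0\<close> by (simp add: Su Sw distrib_left)
  then have "a \<le> Re z"
    using pos by simp
  moreover have "Re z * (u \<bullet> u + w \<bullet> w) \<le> b * (u \<bullet> u + w \<bullet> w)"
    using upper[of u] upper[of w] \<open>Im z = 0\<close> by (simp add: Su Sw distrib_left)
  then have "Re z \<le> b"
    using pos by simp
  ultimately show "z \<in> complex_of_real ` {a..b}"
    by (intro image_eqI[of _ _ "Re z"]) (auto simp: complex_eq_iff)
qed

section \<open>The space \<open>V\<close>, the energy gradient and the Grassmann gradient\<close>

lemma H1_subspace_dim_L2:
  assumes "H1_subspace_dim V m" "f \<in> V"
  shows "L2 f"
proof -
  from assms obtain \<phi> c where "\<forall>k<m. \<phi> k \<in> H1" "f = (\<lambda>x. \<Sum>k<m. c k * \<phi> k x)"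
    unfolding H1_subspace_dim_def by blast
  then show ?thesis
    by (auto simp: H1_def intro: L2_sum)
qed

text \<open>Needed because the gradient of the energy is described only at tuples from
  \<open>V\<close>, and the scheme evaluates it at midpoints.\<close>

lemma tuple_midpoint_in_tuples:
  assumes "H1_subspace_dim V m" "X \<in> tuples V" "Y \<in> tuples V"
  shows "tuple_midpoint X Y \<in> tuples V"
proof -
  obtain \<phi> where V: "V = {(\<lambda>x. \<Sum>k<m. c k * \<phi> k x) | c::nat \<Rightarrow> real. True}"
    using assms(1) unfolding H1_subspace_dim_def by blast
  have "(\<lambda>x. (g x + f x) / 2) \<in> V" if "f \<in> V" "g \<in> V" for f g
  proof -
    obtain c d where "f = (\<lambda>x. \<Sum>k<m. c k * \<phi> k x)" "g = (\<lambda>x. \<Sum>k<m. d k * \<phi> k x)"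
      using \<open>f \<in> V\<close> \<open>g \<in> V\<close> unfolding V by blast
    then have "(\<lambda>x. (g x + f x) / 2) = (\<lambda>x. \<Sum>k<m. ((d k + c k) / 2) * \<phi> k x)"
      by (simp add: fun_eq_iff sum_divide_distrib sum.distrib distrib_right add_divide_distrib)
    then show ?thesis
      unfolding V by (intro CollectI exI[of _ "\<lambda>k. (d k + c k) / 2"]) simp
  qed
  then show ?thesis
    using assms by (simp add: tuples_def tuple_midpoint_def)
qed

text \<open>Test the formula for entry \<open>i\<close> with \<open>v = W j\<close>: the kinetic
  term is symmetric in \<open>i\<close> and \<open>j\<close>, and the other three multiply by
  potentials that do not depend on the index.\<close>

lemma gram_kohn_sham_gradient_symmetric:
  assumes "kohn_sham_gradient_formula V Vext vxc W G" "W \<in> tuples V"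
  shows "transpose (gram W G) = gram W G"
proof -
  have "l2_inner (\<lambda>r. q r * W i r) (W j) = l2_inner (\<lambda>r. q r * W j r) (W i)" for q i j
    by (simp add: l2_inner_def mult_ac)
  then have "l2_inner (G i) (W j) = l2_inner (G j) (W i)" for i j
    using assms unfolding kohn_sham_gradient_formula_def tuples_def
    by (simp add: inner_commute)
  then show ?thesis
    by (simp add: vec_eq_iff transpose_def gram_nth l2_inner_commute[of "W _"])
qed

text \<open>The first Gram matrix is the commutator of two symmetric matrices, and the second is its
  transpose.\<close>

lemma gram_grassmann_gradient_antisymmetric:
  assumes "\<And>i. L2 (W i)" "\<And>i. L2 (gradE W i)"
    and sym: "transpose (gram W (gradE W)) = gram W (gradE W)"
  shows "gram W (grassmann_gradient gradE W) + gram (grassmann_gradient gradE W) W = 0"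
proof -
  have "gram W (grassmann_gradient gradE W)
      = gram W (gradE W) ** gram W W - gram W W ** gram W (gradE W)"
    using assms
    by (simp add: grassmann_gradient_def gram_tuple_diff_right gram_tuple_mult_right L2_tuple_mult)
  then show ?thesis
    using commutator_add_transpose[OF sym transpose_gram]
    by (simp flip: transpose_gram[of W "grassmann_gradient gradE W"])
qed

theorem proposition4p6:
  fixes V :: "(real^3 \<Rightarrow> real) set"
    and Ng :: nat
    and Vext :: "real^3 \<Rightarrow> real"
    and \<epsilon>xc vxc :: "(real^3 \<Rightarrow> real) \<Rightarrow> (real^3 \<Rightarrow> real)"
    and gradE :: "('n::finite \<Rightarrow> real^3 \<Rightarrow> real) \<Rightarrow> ('n \<Rightarrow> real^3 \<Rightarrow> real)"
    and \<Delta>t :: "nat \<Rightarrow> real"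
    and U :: "nat \<Rightarrow> 'n \<Rightarrow> real^3 \<Rightarrow> real"
  assumes V: "H1_subspace_dim V Ng"
    and Vext: "external_potential_on V Vext"
    and xc: "xc_potential_on V \<epsilon>xc vxc"
    and gradient: "\<And>W. W \<in> tuples V \<Longrightarrow> has_gradient_on V (energy Vext \<epsilon>xc) W (gradE W)"
    and gradient_formula:
      "\<And>W. W \<in> tuples V \<Longrightarrow> kohn_sham_gradient_formula V Vext vxc W (gradE W)"
    and initial: "U 0 \<in> tuples V \<inter> stiefel"
    and in_V: "\<And>n. U n \<in> tuples V"
    and step_pos: "\<And>n. \<Delta>t n > 0"
    and scheme: "\<And>n i x. (U (Suc n) i x - U n i x) / \<Delta>t n
                   = - grassmann_gradient gradE (tuple_midpoint (U n) (U (Suc n))) i x"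
  shows "spectrum (map_matrix complex_of_real
           (gram (tuple_midpoint (U n) (U (Suc n))) (tuple_midpoint (U n) (U (Suc n)))))
         \<subseteq> complex_of_real ` {0..1}"
proof -
  define W where "W = (\<lambda>n. tuple_midpoint (U n) (U (Suc n)))"
  define K where "K = (\<lambda>n. grassmann_gradient gradE (W n))"
  have W_in_V: "W n \<in> tuples V" for n
    unfolding W_def using V in_V in_V by (rule tuple_midpoint_in_tuples)
  have L2_W: "L2 (W n i)" for n i
    using W_in_V V by (auto simp: tuples_def intro: H1_subspace_dim_L2)
  have L2_grad: "L2 (gradE (W n) i)" for n i
    using gradient[OF W_in_V] V
    by (auto simp: has_gradient_on_def tuples_def intro: H1_subspace_dim_L2)
  have L2_K: "L2 (K n i)" for n i
    unfolding K_def grassmann_gradient_def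
    by (intro L2_tuple_diff L2_tuple_mult L2_W L2_grad)
  have antisym: "gram (W n) (K n) + gram (K n) (W n) = 0" for n
    unfolding K_def
    using L2_W L2_grad gram_kohn_sham_gradient_symmetric[OF gradient_formula[OF W_in_V] W_in_V]
    by (rule gram_grassmann_gradient_antisymmetric)
  \<comment> \<open>The linear term cancels by \<open>antisym\<close>, so the sign of
    \<open>c\<close> does not matter.\<close>
  have shift: "gram (\<lambda>i x. W n i x + c * K n i x) (\<lambda>i x. W n i x + c * K n i x)
      = gram (W n) (W n) + c\<^sup>2 *\<^sub>R gram (K n) (K n)" for n c
    by (simp add: gram_add_scaled L2_W L2_K antisym)
  have step: "U (Suc n) i x = U n i x - \<Delta>t n * K n i x" for n i x
    using scheme[of n i x] step_pos[of n] by (simp add: K_def W_def field_simps)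
  have mid: "W n i x = (U (Suc n) i x + U n i x) / 2" for n i x
    by (simp add: W_def tuple_midpoint_def)
  \<comment> \<open>The midpoint lies half a step, \<open>\<Delta>t n / 2\<close> times
    \<open>K n\<close>, away from either end, with opposite signs.\<close>
  have U_n: "U n = (\<lambda>i x. W n i x + \<Delta>t n / 2 * K n i x)" for n
    by (simp add: fun_eq_iff mid step field_simps)
  have U_Suc: "U (Suc n) = (\<lambda>i x. W n i x + (- \<Delta>t n / 2) * K n i x)" for n
    by (simp add: fun_eq_iff mid step field_simps)
  have gram_U_n: "gram (U n) (U n)
      = gram (W n) (W n) + (\<Delta>t n / 2)\<^sup>2 *\<^sub>R gram (K n) (K n)" for n
    using shift[of n "\<Delta>t n / 2"] by (simp only: flip: U_n)
  have gram_U_Suc: "gram (U (Suc n)) (U (Suc n))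
      = gram (W n) (W n) + (\<Delta>t n / 2)\<^sup>2 *\<^sub>R gram (K n) (K n)" for n
    using shift[of n "- \<Delta>t n / 2"] by (simp only: flip: U_Suc) simp
  \<comment> \<open>\<open>gram_U_n\<close> and \<open>gram_U_Suc\<close> have the same right-hand
    side, so the Gram matrix of \<open>U 0\<close> is carried along.\<close>
  have orthonormal: "gram (U n) (U n) = mat 1" for n
  proof (induction n)
    case 0
    then show ?case
      using initial by (simp add: stiefel_def)
  next
    case (Suc n)
    then show ?case
      by (simp only: gram_U_Suc flip: gram_U_n)
  qed
  \<comment> \<open>The gap between the two sides is \<open>(\<Delta>t n / 2)^2\<close> times the
    nonnegative form of \<open>gram (K n) (K n)\<close>.\<close>
  have "v \<bullet> (gram (W n) (W n) *v v) \<le> v \<bullet> v" for v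
  proof -
    have "v \<bullet> v = v \<bullet> (gram (U n) (U n) *v v)"
      by (simp add: orthonormal)
    also have "\<dots> = v \<bullet> (gram (W n) (W n) *v v)
        + (\<Delta>t n / 2)\<^sup>2 * (v \<bullet> (gram (K n) (K n) *v v))"
      by (simp add: gram_U_n matrix_vector_mult_add_rdistrib scaleR_matrix_vector_assoc[symmetric]
          inner_add_right)
    finally show ?thesis
      using gram_form_nonneg[of "K n" v, OF L2_K] by simp
  qed
  then have "spectrum (map_matrix complex_of_real (gram (W n) (W n))) \<subseteq> complex_of_real ` {0..1}"
    by (intro spectrum_symmetric_subset) (simp_all add: transpose_gram gram_form_nonneg L2_W)
  then show ?thesis
    by (simp add: W_def)
qed

end
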